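(* Let $F$ be the face $(U_{2,3}^{123},U_{2,3}^{124})$ of $\Gamma_4$. For real $a,b\ge 0$, the point $\mathbf h=(a,b)\in F$ is entropic if and only if $a=\log v_1$ and $b=\log v_2$ for some positive integers $v_1,v_2$.
   Context: $N_4=\{1,2,3,4\}$. $\Gamma_4$ is the cone of all polymatroid rank functions on $N_4$. A set function $\mathbf h:2^{N_4}\to\mathbb R$ is called entropic if there is a random vector $(X_1,X_2,X_3,X_4)$, each $X_i$ taking values in a finite set, with $\mathbf h(A)=H(X_A)$ for all $A\subseteq N_4$, where $H$ is Shannon entropy, $X_A=(X_j,j\in A)$ and $\mathbf h(\emptyset)=0$. Logarithms (also in the entropy) are to base $2$. For two (poly)matroids $M_1,M_2$ on $N_4$ with rank functions $\mathbf r_1,\mathbf r_2$, $(M_1,M_2)$ denotes the face $\{a\mathbf r_1+b\mathbf r_2:a,b\ge0\}$ of $\Gamma_4$, and $(a,b)$ denotes the point $a\mathbf r_1+b\mathbf r_2$. For $\alpha\subseteq N_4$ with $|\alpha|=3$, $U^\alpha_{2,3}$ is the matroid on $N_4$ with rank function $\mathbf r(A)=\min\{2,|A\cap\alpha|\}$. Superscripts such as $123$ abbreviate $\{1,2,3\}$. *)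

theory Defs
  imports "HOL-Probability.Probability"
begin

abbreviation N4 :: "nat set" where
  "N4 \<equiv> {1, 2, 3, 4}"

text \<open>Set functions on the power set of \<open>N4\<close> are modelled as total functions on
  \<open>nat set\<close>; only their values at subsets of \<open>N4\<close> are meaningful.\<close>

type_synonym set_function = "nat set \<Rightarrow> real"

definition Gamma4 :: "set_function set" where
  "Gamma4 = {h. h {} = 0
    \<and> (\<forall>A B. A \<subseteq> B \<and> B \<subseteq> N4 \<longrightarrow> h A \<le> h B)
    \<and> (\<forall>A B. A \<subseteq> N4 \<and> B \<subseteq> N4 \<longrightarrow> h (A \<union> B) + h (A \<inter> B) \<le> h A + h B)}"

text \<open>The rank function of the matroid $U^{\alpha}_{2,3}$ on \<open>N4\<close>, for \<open>\<alpha> \<subseteq> N4\<close> with three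
  elements.\<close>

definition U23 :: "nat set \<Rightarrow> set_function" where
  "U23 \<alpha> A = real (min 2 (card (A \<inter> \<alpha>)))"

definition point :: "set_function \<Rightarrow> set_function \<Rightarrow> real \<Rightarrow> real \<Rightarrow> set_function" where
  "point r1 r2 a b = (\<lambda>A. a * r1 A + b * r2 A)"

definition face :: "set_function \<Rightarrow> set_function \<Rightarrow> set_function set" where
  "face r1 r2 = {h. \<exists>a b. a \<ge> 0 \<and> b \<ge> 0 \<and> (\<forall>A\<subseteq>N4. h A = point r1 r2 a b A)}"

lemma U23_submodular:
  assumes "finite \<alpha>"
  shows "U23 \<alpha> (A \<union> B) + U23 \<alpha> (A \<inter> B) \<le> U23 \<alpha> A + U23 \<alpha> B"
proof -
  have "card (A \<inter> \<alpha>) + card (B \<inter> \<alpha>) = card ((A \<inter> \<alpha>) \<union> (B \<inter> \<alpha>)) + card ((A \<inter> \<alpha>) \<inter> (B \<inter> \<alpha>))"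
    using assms by (intro card_Un_Int) auto
  moreover have "(A \<inter> \<alpha>) \<union> (B \<inter> \<alpha>) = (A \<union> B) \<inter> \<alpha>" "(A \<inter> \<alpha>) \<inter> (B \<inter> \<alpha>) = (A \<inter> B) \<inter> \<alpha>" by auto
  ultimately have "card (A \<inter> \<alpha>) + card (B \<inter> \<alpha>) = card ((A \<union> B) \<inter> \<alpha>) + card ((A \<inter> B) \<inter> \<alpha>)" by simp
  moreover have "card ((A \<inter> B) \<inter> \<alpha>) \<le> card (A \<inter> \<alpha>)" "card ((A \<inter> B) \<inter> \<alpha>) \<le> card (B \<inter> \<alpha>)"
    using assms by (auto intro!: card_mono)
  ultimately show ?thesis unfolding U23_def by linarith
qed

lemma U23_mono:
  assumes "finite \<alpha>" "A \<subseteq> B"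
  shows "U23 \<alpha> A \<le> U23 \<alpha> B"
proof -
  have "card (A \<inter> \<alpha>) \<le> card (B \<inter> \<alpha>)" using assms by (intro card_mono) auto
  then show ?thesis unfolding U23_def by linarith
qed

lemma face_subset_Gamma4:
  assumes "finite \<alpha>" "finite \<beta>"
  shows "face (U23 \<alpha>) (U23 \<beta>) \<subseteq> Gamma4"
proof
  fix h assume "h \<in> face (U23 \<alpha>) (U23 \<beta>)"
  then obtain a b where a: "a \<ge> 0" and b: "b \<ge> 0"
    and h: "\<And>A. A \<subseteq> N4 \<Longrightarrow> h A = a * U23 \<alpha> A + b * U23 \<beta> A"
    by (auto simp: face_def point_def)
  have "h A \<le> h B" if "A \<subseteq> B" "B \<subseteq> N4" for A B
    using that a b h[of A] h[of B] U23_mono[OF assms(1)] U23_mono[OF assms(2)]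
    by (auto intro!: add_mono mult_left_mono)
  moreover have "h (A \<union> B) + h (A \<inter> B) \<le> h A + h B" if AB: "A \<subseteq> N4" "B \<subseteq> N4" for A B
  proof -
    have 1: "A \<union> B \<subseteq> N4" "A \<inter> B \<subseteq> N4" using AB by blast+
    show ?thesis
      using mult_left_mono[OF U23_submodular[OF assms(1), of A B] a]
        mult_left_mono[OF U23_submodular[OF assms(2), of A B] b]
      unfolding h[OF AB(1)] h[OF AB(2)] h[OF 1(1)] h[OF 1(2)]
      by (simp add: distrib_left)
  qed
  moreover have "h {} = 0" using h[of "{}"] by (simp add: U23_def)
  ultimately show "h \<in> Gamma4" by (auto simp: Gamma4_def)
qed

lemma subset_N4_cases:
  assumes "A \<subseteq> N4"
  shows "A \<in> {{}, {1}, {2}, {3}, {4}, {1,2}, {1,3}, {1,4}, {2,3}, {2,4}, {3,4},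
    {1,2,3}, {1,2,4}, {1,3,4}, {2,3,4}, {1,2,3,4}}"
proof -
  have "A \<in> Pow N4" using assms by simp
  then show ?thesis by (simp add: Pow_insert image_insert insert_commute disj_ac)
qed

text \<open>The set in question is indeed a face of the convex cone \<open>Gamma4\<close>: if a sum of two elements
  of the cone lies in it, then so do the summands.\<close>

lemma face_is_face:
  assumes x: "x \<in> Gamma4" and y: "y \<in> Gamma4"
    and xy: "(\<lambda>A. x A + y A) \<in> face (U23 {1,2,3}) (U23 {1,2,4})"
  shows "x \<in> face (U23 {1,2,3}) (U23 {1,2,4})"
proof -
  obtain a b where s: "\<And>A. A \<subseteq> N4 \<Longrightarrow> x A + y A = a * U23 {1,2,3} A + b * U23 {1,2,4} A"
    using xy by (auto simp: face_def point_def)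
  have sv':
    "x {} + y {} = 0 * a + 0 * b"
    "x {1} + y {1} = 1 * a + 1 * b"
    "x {2} + y {2} = 1 * a + 1 * b"
    "x {3} + y {3} = 1 * a + 0 * b"
    "x {4} + y {4} = 0 * a + 1 * b"
    "x {1,2} + y {1,2} = 2 * a + 2 * b"
    "x {1,3} + y {1,3} = 2 * a + 1 * b"
    "x {1,4} + y {1,4} = 1 * a + 2 * b"
    "x {2,3} + y {2,3} = 2 * a + 1 * b"
    "x {2,4} + y {2,4} = 1 * a + 2 * b"
    "x {3,4} + y {3,4} = 1 * a + 1 * b"
    "x {1,2,3} + y {1,2,3} = 2 * a + 2 * b"
    "x {1,2,4} + y {1,2,4} = 2 * a + 2 * b"
    "x {1,3,4} + y {1,3,4} = 2 * a + 2 * b"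
    "x {2,3,4} + y {2,3,4} = 2 * a + 2 * b"
    "x {1,2,3,4} + y {1,2,3,4} = 2 * a + 2 * b"
    by (simp_all add: s U23_def)
  have ineq: "h {} = 0 \<and> 0 \<le> h {3} \<and> 0 \<le> h {4} \<and> h {1,2} \<le> h {1} + h {2}
      \<and> h {1,3} \<le> h {1} + h {3} \<and> h {1,4} \<le> h {1} + h {4} \<and> h {3,4} \<le> h {3} + h {4}
      \<and> h {2,3} \<le> h {2} + h {3} \<and> h {2,4} \<le> h {2} + h {4}
      \<and> h {1,2} \<le> h {1,2,3} \<and> h {1,2} \<le> h {1,2,4} \<and> h {1,2,3} \<le> h {1,2,3,4}
      \<and> h {1,2,4} \<le> h {1,2,3,4} \<and> h {1,3,4} \<le> h {1,2,3,4} \<and> h {2,3,4} \<le> h {1,2,3,4}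
      \<and> h {1,3,4} + h {1} \<le> h {1,3} + h {1,4} \<and> h {2,3,4} + h {2} \<le> h {2,3} + h {2,4}"
    if h: "h \<in> Gamma4" for h
  proof -
    have e: "h {} = 0" using h by (simp add: Gamma4_def)
    have m: "h A \<le> h B" if "A \<subseteq> B" "B \<subseteq> N4" for A B using h that by (simp add: Gamma4_def)
    have sub: "h (A \<union> B) + h (A \<inter> B) \<le> h A + h B" if "A \<subseteq> N4" "B \<subseteq> N4" for A B
      using h that by (simp add: Gamma4_def)
    note u = e m[of "{}" "{3}"] m[of "{}" "{4}"] m[of "{1,2}" "{1,2,3}"] m[of "{1,2}" "{1,2,4}"]
      m[of "{1,2,3}" "{1,2,3,4}"] m[of "{1,2,4}" "{1,2,3,4}"] m[of "{1,3,4}" "{1,2,3,4}"]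
      m[of "{2,3,4}" "{1,2,3,4}"] sub[of "{1}" "{2}"] sub[of "{1}" "{3}"] sub[of "{1}" "{4}"]
      sub[of "{3}" "{4}"] sub[of "{2}" "{3}"] sub[of "{2}" "{4}"]
      sub[of "{1,3}" "{1,4}"] sub[of "{2,3}" "{2,4}"]
    show ?thesis using u by (simp add: insert_commute)
  qed
  have all: "x {1,2} = 2 * x {3} + 2 * x {4} \<and> x {1} = x {3} + x {4} \<and> x {2} = x {3} + x {4}
      \<and> x {1,3} = 2 * x {3} + x {4} \<and> x {1,4} = x {3} + 2 * x {4}
      \<and> x {2,3} = 2 * x {3} + x {4} \<and> x {2,4} = x {3} + 2 * x {4}
      \<and> x {3,4} = x {3} + x {4}
      \<and> x {1,2,3} = 2 * x {3} + 2 * x {4} \<and> x {1,2,4} = 2 * x {3} + 2 * x {4}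
      \<and> x {1,3,4} = 2 * x {3} + 2 * x {4} \<and> x {2,3,4} = 2 * x {3} + 2 * x {4}
      \<and> x {1,2,3,4} = 2 * x {3} + 2 * x {4}"
    using ineq[OF x] ineq[OF y] sv'
    by (elim conjE, intro conjI; linarith)
  show ?thesis
    unfolding face_def point_def mem_Collect_eq
  proof (intro exI conjI allI impI)
    show "0 \<le> x {3}" "0 \<le> x {4}" using ineq[OF x] by auto
    have e: "x {} = 0" using ineq[OF x] by simp
    have "\<forall>A\<in>{{}, {1}, {2}, {3}, {4}, {1,2}, {1,3}, {1,4}, {2,3}, {2,4}, {3,4},
      {1,2,3}, {1,2,4}, {1,3,4}, {2,3,4}, {1,2,3,4}}.
        x A = x {3} * U23 {1,2,3} A + x {4} * U23 {1,2,4} A"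
      using all e by (simp add: U23_def)
    then show "x A = x {3} * U23 {1,2,3} A + x {4} * U23 {1,2,4} A" if "A \<subseteq> N4" for A
      using subset_N4_cases[OF that] by (rule bspec)
  qed
qed

text \<open>\<open>joint X A\<close> is the subvector $X_A$.  For empty \<open>A\<close> it is constant, so its entropy is 0.\<close>

definition joint :: "(nat \<Rightarrow> 'w \<Rightarrow> 'x) \<Rightarrow> nat set \<Rightarrow> 'w \<Rightarrow> nat \<Rightarrow> 'x" where
  "joint X A = (\<lambda>\<omega>. \<lambda>i\<in>A. X i \<omega>)"

definition joint_entropy :: "'w measure \<Rightarrow> (nat \<Rightarrow> 'w \<Rightarrow> 'x) \<Rightarrow> nat set \<Rightarrow> real" where
  "joint_entropy M X A =
     prob_space.entropy M 2 (count_space (joint X A ` space M)) (joint X A)"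

text \<open>\<open>simple_function M (X i)\<close> says that \<open>X i\<close> is a random variable with finitely many values.
  A definition cannot quantify over types, so the sample space is of type \<open>nat \<Rightarrow> nat\<close> and
  the alphabets are subsets of \<open>nat\<close>; by lemma \<open>entropic_joint_entropy\<close> below this is
  no restriction.\<close>

definition entropic :: "set_function \<Rightarrow> bool" where
  "entropic h \<longleftrightarrow>
    (\<exists>(M :: (nat \<Rightarrow> nat) measure) (X :: nat \<Rightarrow> (nat \<Rightarrow> nat) \<Rightarrow> nat).
       prob_space M \<and> (\<forall>i\<in>N4. simple_function M (X i)) \<and>
       (\<forall>A\<subseteq>N4. h A = joint_entropy M X A))"

lemma simple_function_joint:
  assumes A: "A \<subseteq> N4" and X: "\<forall>i\<in>N4. simple_function M (X i)"
  shows "simple_function M (joint X A)"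
proof -
  have fin: "finite A" using A by (rule finite_subset) simp
  have X': "simple_function M (X i)" if "i \<in> A" for i using X A that by blast
  have sub: "joint X A ` space M \<subseteq> PiE A (\<lambda>i. X i ` space M)"
    by (auto simp: joint_def)
  have "finite (PiE A (\<lambda>i. X i ` space M))"
    by (rule finite_PiE[OF fin]) (use X' in \<open>auto dest: simple_functionD\<close>)
  then have 1: "finite (joint X A ` space M)" using sub finite_subset by blast
  have 2: "joint X A -` {v} \<inter> space M \<in> sets M" if "v \<in> joint X A ` space M" for v
  proof -
    have ext: "v \<in> extensional A" using that by (auto simp: joint_def)
    have "joint X A -` {v} \<inter> space M = {\<omega>\<in>space M. \<forall>i\<in>A. \<omega> \<in> X i -` {v i} \<inter> space M}"
      using ext by (auto simp: joint_def intro!: extensionalityI[of _ A])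
    also have "\<dots> \<in> sets M"
    proof (rule sets.sets_Collect_finite_All[OF _ fin])
      fix i assume i: "i \<in> A"
      have "{\<omega> \<in> space M. \<omega> \<in> X i -` {v i} \<inter> space M} = X i -` {v i} \<inter> space M" by auto
      then show "{\<omega> \<in> space M. \<omega> \<in> X i -` {v i} \<inter> space M} \<in> sets M"
        using simple_functionD(2)[OF X'[OF i], of "{v i}"] by simp
    qed
    finally show ?thesis .
  qed
  show ?thesis using 1 2 by (simp add: simple_function_def)
qed

lemma entropy_simple_sum:
  assumes M: "prob_space M" and V: "simple_function M V"
  shows "prob_space.entropy M 2 (count_space (V ` space M)) V =
    - (\<Sum>x\<in>V ` space M. measure M (V -` {x} \<inter> space M) * log 2 (measure M (V -` {x} \<inter> space M)))"
proof -
  interpret prob_space M by fact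
  interpret information_space M 2 by unfold_locales simp
  have "simple_distributed M V (\<lambda>x. measure M (V -` {x} \<inter> space M))"
    by (rule simple_distributedI[OF V]) auto
  from entropy_simple_distributed[OF this] show ?thesis by simp
qed

lemma entropic_joint_entropy:
  fixes M :: "'w measure" and X :: "nat \<Rightarrow> 'w \<Rightarrow> 'x"
  assumes M: "prob_space M" and X: "\<forall>i\<in>N4. simple_function M (X i)"
    and h: "\<forall>A\<subseteq>N4. h A = joint_entropy M X A"
  shows "entropic h"
proof -
  define R where "R = (\<Union>i\<in>N4. X i ` space M)"
  have "finite R" using X by (auto simp: R_def dest: simple_functionD)
  then obtain e :: "'x \<Rightarrow> nat" where e: "inj_on e R"
    by (metis finite_imp_inj_to_nat_seg)
  define Y where "Y = (\<lambda>i \<omega>. e (X i \<omega>))"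
  define W where "W = joint Y N4"
  have Y: "\<forall>i\<in>N4. simple_function M (Y i)"
    using X simple_function_compose[where g = e] by (auto simp: Y_def comp_def)
  have W: "simple_function M W" unfolding W_def by (rule simple_function_joint[OF _ Y]) simp
  define K where "K = distr M (count_space (W ` space M)) W"
  have meas: "W \<in> measurable M (count_space (W ` space M))"
    using simple_functionD(2)[OF W] by (auto simp: measurable_def)
  have K: "prob_space K" unfolding K_def by (rule prob_space.prob_space_distr[OF M meas])
  have spK: "space K = W ` space M" by (simp add: K_def)
  have finW: "finite (W ` space M)" using W by (rule simple_functionD)
  have simpK: "simple_function K f" for f :: "(nat \<Rightarrow> nat) \<Rightarrow> 'c"
    using finW by (auto simp: simple_function_def spK) (auto simp: K_def)
  have eq: "joint_entropy K (\<lambda>i f. f i) A = joint_entropy M X A" if A: "A \<subseteq> N4" for A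
  proof -
    let ?V = "joint X A" and ?V' = "joint (\<lambda>i f. f i) A :: (nat \<Rightarrow> nat) \<Rightarrow> _"
    define E where "E = (\<lambda>v. \<lambda>i\<in>A. e (v i :: 'x))"
    have VW: "?V' (W \<omega>) = E (?V \<omega>)" for \<omega>
      using A by (auto simp: joint_def W_def E_def Y_def fun_eq_iff restrict_def)
    have inj: "inj_on E (?V ` space M)"
    proof (rule inj_onI)
      fix v w assume v: "v \<in> ?V ` space M" and w: "w \<in> ?V ` space M" and vw: "E v = E w"
      have "v \<in> extensional A" "w \<in> extensional A" using v w by (auto simp: joint_def)
      moreover have "v i = w i" if i: "i \<in> A" for i
      proof -
        have "e (v i) = e (w i)" using fun_cong[OF vw, of i] i by (simp add: E_def)
        moreover have "v i \<in> R" "w i \<in> R" using v w i A by (auto simp: joint_def R_def)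
        ultimately show ?thesis using e by (auto dest: inj_onD)
      qed
      ultimately show "v = w" by (rule extensionalityI)
    qed
    have img: "?V' ` space K = E ` (?V ` space M)"
      by (simp add: spK image_image VW)
    have pr: "measure K (?V' -` {E x} \<inter> space K) = measure M (?V -` {x} \<inter> space M)"
      if x: "x \<in> ?V ` space M" for x
    proof -
      have "measure K (?V' -` {E x} \<inter> space K) = measure M (W -` (?V' -` {E x} \<inter> space K) \<inter> space M)"
        unfolding K_def by (rule measure_distr[OF meas]) auto
      also have "W -` (?V' -` {E x} \<inter> space K) \<inter> space M = ?V -` {x} \<inter> space M"
      proof -
        have "?V' (W \<omega>) = E x \<longleftrightarrow> ?V \<omega> = x" if "\<omega> \<in> space M" for \<omega>
          unfolding VW using inj_on_eq_iff[OF inj _ x, of "?V \<omega>"] that by blast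
        then show ?thesis by (auto simp: spK)
      qed
      finally show ?thesis .
    qed
    show ?thesis
      unfolding joint_entropy_def entropy_simple_sum[OF M simple_function_joint[OF A X]]
        entropy_simple_sum[OF K simpK[of ?V']]
      by (simp add: img sum.reindex[OF inj] pr)
  qed
  show ?thesis
    unfolding entropic_def using K simpK h eq by (intro exI[of _ K] exI[of _ "\<lambda>i f. f i"]) auto
qed

end

theory Submission
  imports Defs
begin

text \<open>In an entropic point of the face, $X_1, X_2$ are independent, $X_3, X_4$ are independent, each
  of $X_1, X_2$ is independent of $(X_3, X_4)$, and each of $X_{12}, X_{134}, X_{234}$ determines
  the whole vector.  So every atom $(x_1, x_2, x_3, x_4)$ of positive mass satisfies
  $p_1(x_1) p_2(x_2) = p_1(x_1) p_3(x_3) p_4(x_4) = p_2(x_2) p_3(x_3) p_4(x_4)$, whence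
  $p_1(x_1) = p_2(x_2) = p_3(x_3) p_4(x_4)$.  By independence all pairs $(x_1, x_2)$ and all pairs
  $(x_3, x_4)$ of values of positive mass occur in such atoms, so these quantities are constant and
  $X_3$, $X_4$ are uniform.  Conversely, let $U, U'$ be independent and uniform on $Z/v_1$, let
  $W, W'$ be independent of them and of each other and uniform on $Z/v_2$, and put
  $X_1 = (U, W)$, $X_2 = (U', W')$, $X_3 = U + U'$, $X_4 = W + W'$.\<close>

section \<open>Gibbs inequality and entropies of finitely valued variables\<close>

text \<open>For p > 0 put x = u v / p; dividing by p leaves \<open>ln x \<le> x - 1\<close>, where
  equality forces x = 1. The bounds p \<le> u and p \<le> v make u and v positive in that case and
  nonnegative when p = 0.\<close>

lemma gibbs_term:
  fixes p u v :: real
  assumes "0 \<le> p" "p \<le> u" "p \<le> v"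
  shows "p - u * v \<le> p * (ln p - ln u - ln v)"
    and "p - u * v = p * (ln p - ln u - ln v) \<Longrightarrow> p = u * v"
proof -
  have *: "p - u * v \<le> p * (ln p - ln u - ln v) \<and>
    (p - u * v = p * (ln p - ln u - ln v) \<longrightarrow> p = u * v)"
  proof (cases "p = 0")
    case True
    then show ?thesis using assms by simp
  next
    case False
    then have pos: "0 < p" "0 < u" "0 < v" using assms by auto
    define x where "x = u * v / p"
    have x: "0 < x" using pos by (simp add: x_def)
    have l: "ln p - ln u - ln v = - ln x" and e: "p - u * v = p * (1 - x)"
      using pos by (simp_all add: x_def ln_div ln_mult field_simps)
    have "p * (1 - x) \<le> p * - ln x"
      using ln_le_minus_one[OF x] pos by (intro mult_left_mono) auto
    moreover have "p = u * v" if "p * (1 - x) = p * - ln x"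
    proof -
      have "1 - x = - ln x" using that pos by (metis less_irrefl mult_left_cancel)
      then have "x = 1" using ln_eq_minus_one[OF x] by simp
      then show ?thesis using pos by (simp add: x_def)
    qed
    ultimately show ?thesis unfolding l e by blast
  qed
  from * show "p - u * v \<le> p * (ln p - ln u - ln v)" by blast
  from * show "p = u * v" if "p - u * v = p * (ln p - ln u - ln v)" using that by blast
qed

lemma (in prob_space) prob_comp_eq_sum:
  assumes V: "simple_function M V"
  shows "prob ((f \<circ> V) -` {x} \<inter> space M) =
    (\<Sum>y\<in>{y\<in>V ` space M. f y = x}. prob (V -` {y} \<inter> space M))"
proof -
  have "(f \<circ> V) -` {x} \<inter> space M = (\<Union>y\<in>{y\<in>V ` space M. f y = x}. V -` {y} \<inter> space M)"
    by auto
  moreover have "prob (\<Union>y\<in>{y\<in>V ` space M. f y = x}. V -` {y} \<inter> space M) =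
      (\<Sum>y\<in>{y\<in>V ` space M. f y = x}. prob (V -` {y} \<inter> space M))"
    by (rule finite_measure_finite_Union)
      (use simple_functionD[OF V] in \<open>auto simp: disjoint_family_on_def\<close>)
  ultimately show ?thesis by simp
qed

lemma (in prob_space) sum_prob_range:
  assumes V: "simple_function M V"
  shows "(\<Sum>y\<in>V ` space M. prob (V -` {y} \<inter> space M)) = 1"
proof -
  have "((\<lambda>_. ()) \<circ> V) -` {()} \<inter> space M = space M" by auto
  then show ?thesis
    using prob_comp_eq_sum[OF V, of "\<lambda>_. ()" "()"] by (simp add: prob_space)
qed

text \<open>Grouping the atoms of \<open>V\<close> by their image under \<open>f\<close> gives this
  form. With entropies of different functions of \<open>V\<close> all written as sums over the atoms
  of \<open>V\<close>, they can be compared term by term.\<close>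

lemma (in prob_space) entropy_comp:
  assumes V: "simple_function M V"
  shows "prob_space.entropy M 2 (count_space ((f \<circ> V) ` space M)) (f \<circ> V) =
    - (\<Sum>y\<in>V ` space M. prob (V -` {y} \<inter> space M) *
        log 2 (prob ((f \<circ> V) -` {f y} \<inter> space M)))"
proof -
  have fin: "finite (V ` space M)" using V by (rule simple_functionD)
  have "(\<Sum>x\<in>(f \<circ> V) ` space M. prob ((f \<circ> V) -` {x} \<inter> space M) *
        log 2 (prob ((f \<circ> V) -` {x} \<inter> space M))) =
      (\<Sum>x\<in>f ` (V ` space M). \<Sum>y\<in>{y\<in>V ` space M. f y = x}.
        prob (V -` {y} \<inter> space M) * log 2 (prob ((f \<circ> V) -` {f y} \<inter> space M)))"
    by (rule sum.cong)
      (auto simp: image_comp prob_comp_eq_sum[OF V] sum_distrib_right intro!: sum.cong)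
  also have "\<dots> = (\<Sum>y\<in>V ` space M. prob (V -` {y} \<inter> space M) *
        log 2 (prob ((f \<circ> V) -` {f y} \<inter> space M)))"
    by (rule sum.image_gen[OF fin, symmetric])
  finally show ?thesis
    using entropy_simple_sum[OF prob_space_axioms simple_function_compose[OF V, of f]]
    by simp
qed

text \<open>The entropy lost by applying \<open>f\<close> is the sum of p (log u - log p), with p
  the mass of an atom and u \<ge> p the mass of the fibre around it. All terms are nonnegative, so a
  zero loss makes each of them vanish.\<close>

lemma (in prob_space) entropy_comp_eq_imp_prob_eq:
  assumes V: "simple_function M V"
    and H: "prob_space.entropy M 2 (count_space ((f \<circ> V) ` space M)) (f \<circ> V) =
      prob_space.entropy M 2 (count_space (V ` space M)) V"
    and y: "y \<in> V ` space M" and pos: "0 < prob (V -` {y} \<inter> space M)"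
  shows "prob ((f \<circ> V) -` {f y} \<inter> space M) = prob (V -` {y} \<inter> space M)"
proof -
  let ?p = "\<lambda>y. prob (V -` {y} \<inter> space M)"
  let ?u = "\<lambda>y. prob ((f \<circ> V) -` {f y} \<inter> space M)"
  have fin: "finite (V ` space M)" using V by (rule simple_functionD)
  have sf: "simple_function M (f \<circ> V)" using V by (rule simple_function_compose)
  have le: "?p y \<le> ?u y" for y
    by (rule finite_measure_mono) (use simple_functionD(2)[OF sf, of "{f y}"] in auto)
  have nn: "0 \<le> ?p y * (log 2 (?u y) - log 2 (?p y))" for y
  proof (cases "?p y = 0")
    case False
    then have "0 < ?p y" by (simp add: zero_less_measure_iff)
    then show ?thesis using le[of y] by (intro mult_nonneg_nonneg) auto
  qed auto
  have "(\<Sum>y\<in>V ` space M. ?p y * (log 2 (?u y) - log 2 (?p y))) = 0"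
    using H unfolding entropy_comp[OF V] entropy_simple_sum[OF prob_space_axioms V]
    by (simp add: right_diff_distrib sum_subtractf)
  then have "?p y * (log 2 (?u y) - log 2 (?p y)) = 0"
    by (rule sum_nonneg_0[OF fin _ _ y, rotated]) (rule nn)
  then have "log 2 (?u y) = log 2 (?p y)" using pos by simp
  then show ?thesis using pos le[of y] by (simp add: log_def)
qed

text \<open>Vanishing mutual information means independence: this is the equality case of Gibbs'
  inequality, between the joint distribution and the product of the marginals.\<close>

lemma (in prob_space) entropy_add_imp_prob_mult:
  assumes U: "simple_function M U" and V: "simple_function M V"
    and H: "prob_space.entropy M 2 (count_space ((\<lambda>\<omega>. (U \<omega>, V \<omega>)) ` space M)) (\<lambda>\<omega>. (U \<omega>, V \<omega>)) =
      prob_space.entropy M 2 (count_space (U ` space M)) U +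
      prob_space.entropy M 2 (count_space (V ` space M)) V"
    and s: "s \<in> U ` space M" and t: "t \<in> V ` space M"
  shows "prob ((\<lambda>\<omega>. (U \<omega>, V \<omega>)) -` {(s, t)} \<inter> space M) =
    prob (U -` {s} \<inter> space M) * prob (V -` {t} \<inter> space M)"
proof -
  let ?W = "\<lambda>\<omega>. (U \<omega>, V \<omega>)"
  let ?S = "U ` space M \<times> V ` space M"
  let ?p = "\<lambda>w. prob (?W -` {w} \<inter> space M)"
  let ?u = "\<lambda>w. prob (U -` {fst w} \<inter> space M)"
  let ?v = "\<lambda>w. prob (V -` {snd w} \<inter> space M)"
  have W: "simple_function M ?W" using U V by (rule simple_function_Pair)
  have finU: "finite (U ` space M)" using U by (rule simple_functionD)
  have finV: "finite (V ` space M)" using V by (rule simple_functionD)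
  have fin: "finite ?S" using finU finV by simp
  have fc: "fst \<circ> ?W = U" "snd \<circ> ?W = V" by auto
  have zero: "?p w = 0" if "w \<notin> ?W ` space M" for w
  proof -
    have "?W -` {w} \<inter> space M = {}" using that by auto
    then show ?thesis by simp
  qed
  \<comment> \<open>The sums must run over the whole product of the ranges, since only there do the
    products u v add up to 1. The added pairs have p = 0.\<close>
  have ext: "(\<Sum>w\<in>?W ` space M. ?p w * g w) = (\<Sum>w\<in>?S. ?p w * g w)" for g
    by (rule sum.mono_neutral_left[OF fin]) (auto intro: zero)
  have HU: "prob_space.entropy M 2 (count_space (U ` space M)) U = - (\<Sum>w\<in>?S. ?p w * log 2 (?u w))"
    using entropy_comp[OF W, of fst] unfolding fc ext .
  have HV: "prob_space.entropy M 2 (count_space (V ` space M)) V = - (\<Sum>w\<in>?S. ?p w * log 2 (?v w))"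
    using entropy_comp[OF W, of snd] unfolding fc ext .
  have "(\<Sum>w\<in>?S. ?p w * (log 2 (?p w) - log 2 (?u w) - log 2 (?v w))) = 0"
    using H unfolding HU HV entropy_simple_sum[OF prob_space_axioms W] ext
    by (simp add: right_diff_distrib sum_subtractf)
  moreover have "(\<Sum>w\<in>?S. ?p w * (log 2 (?p w) - log 2 (?u w) - log 2 (?v w))) =
      (\<Sum>w\<in>?S. ?p w * (ln (?p w) - ln (?u w) - ln (?v w))) / ln 2"
    unfolding sum_divide_distrib by (rule sum.cong) (simp_all add: log_def field_simps)
  ultimately have 1: "(\<Sum>w\<in>?S. ?p w * (ln (?p w) - ln (?u w) - ln (?v w))) = 0"
    by simp
  have 2: "(\<Sum>w\<in>?S. ?p w) = 1"
    using ext[of "\<lambda>_. 1"] sum_prob_range[OF W] by simp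
  have "(\<Sum>w\<in>?S. ?u w * ?v w) =
      (\<Sum>s\<in>U ` space M. prob (U -` {s} \<inter> space M)) * (\<Sum>t\<in>V ` space M. prob (V -` {t} \<inter> space M))"
    by (simp add: sum_product sum.cartesian_product case_prod_beta)
  then have 3: "(\<Sum>w\<in>?S. ?u w * ?v w) = 1"
    by (simp add: sum_prob_range[OF U] sum_prob_range[OF V])
  have le: "?p w \<le> ?u w" "?p w \<le> ?v w" for w
    using simple_functionD(2)[OF U, of "{fst w}"] simple_functionD(2)[OF V, of "{snd w}"]
    by (auto intro!: finite_measure_mono)
  have nn: "0 \<le> ?p w * (ln (?p w) - ln (?u w) - ln (?v w)) - (?p w - ?u w * ?v w)" for w
    using gibbs_term(1)[OF measure_nonneg le] by simp
  \<comment> \<open>Both p and u v have total mass 1, so the nonnegative Gibbs defects sum to zero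
    and each one is zero.\<close>
  have "(\<Sum>w\<in>?S. ?p w * (ln (?p w) - ln (?u w) - ln (?v w)) - (?p w - ?u w * ?v w)) = 0"
    unfolding sum_subtractf 1 2 3 by simp
  then have "?p (s, t) * (ln (?p (s, t)) - ln (?u (s, t)) - ln (?v (s, t)))
      - (?p (s, t) - ?u (s, t) * ?v (s, t)) = 0"
    by (rule sum_nonneg_0[OF fin, rotated]) (use s t nn in auto)
  then have "?p (s, t) = ?u (s, t) * ?v (s, t)"
    using gibbs_term(2)[OF measure_nonneg le, of "(s, t)"] by simp
  then show ?thesis by simp
qed

text \<open>The event is a finite disjoint union of atoms of \<open>V\<close>, so one of these has
  positive mass. This refines an event of positive probability to a single outcome that represents
  such an atom.\<close>

lemma (in prob_space) ex_pos_atom: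
  assumes V: "simple_function M V" and E: "0 < prob (f -` {x} \<inter> space M)"
    and f: "f = g \<circ> V"
  obtains \<omega> where "\<omega> \<in> space M" "f \<omega> = x" "0 < prob (V -` {V \<omega>} \<inter> space M)"
proof -
  have "0 < (\<Sum>y\<in>{y\<in>V ` space M. g y = x}. prob (V -` {y} \<inter> space M))"
    using E unfolding f prob_comp_eq_sum[OF V] .
  then obtain y where "y \<in> V ` space M" "g y = x" "0 < prob (V -` {y} \<inter> space M)"
    by (metis (mono_tags, lifting) mem_Collect_eq not_less sum_nonpos)
  then show ?thesis using that unfolding f by auto
qed

text \<open>If n atoms have mass c and the others mass 0, then n c = 1 and the entropy is - log c =
  log n.\<close>

lemma (in prob_space) entropy_equal_atoms:
  assumes V: "simple_function M V"
    and c: "\<And>y. y \<in> V ` space M \<Longrightarrow> 0 < prob (V -` {y} \<inter> space M) \<Longrightarrow> prob (V -` {y} \<inter> space M) = c"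
  shows "\<exists>n::nat. 0 < n \<and> prob_space.entropy M 2 (count_space (V ` space M)) V = log 2 n"
proof -
  let ?p = "\<lambda>y. prob (V -` {y} \<inter> space M)"
  define S where "S = {y\<in>V ` space M. 0 < ?p y}"
  have fin: "finite (V ` space M)" using V by (rule simple_functionD)
  have S: "S \<subseteq> V ` space M" "\<And>y. y \<in> S \<Longrightarrow> ?p y = c"
    and nS: "\<And>y. y \<in> V ` space M - S \<Longrightarrow> ?p y = 0"
    using c by (auto simp: S_def zero_less_measure_iff)
  \<comment> \<open>Used twice: g = 1 gives the total mass, g = \<open>log 2\<close> gives the
    entropy.\<close>
  have red: "(\<Sum>y\<in>V ` space M. ?p y * g (?p y)) = real (card S) * (c * g c)" for g
  proof -
    have "(\<Sum>y\<in>V ` space M. ?p y * g (?p y)) = (\<Sum>y\<in>S. ?p y * g (?p y))"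
      by (rule sum.mono_neutral_right[OF fin S(1)]) (simp add: nS)
    also have "\<dots> = (\<Sum>y\<in>S. c * g c)" by (rule sum.cong) (simp_all add: S(2))
    finally show ?thesis by simp
  qed
  have one: "real (card S) * c = 1"
    using red[of "\<lambda>_. 1"] sum_prob_range[OF V] by simp
  then have n: "0 < card S" by (metis gr0I mult_zero_left of_nat_0 zero_neq_one)
  then have "c = 1 / real (card S)" using one by (simp add: field_simps)
  then have "log 2 c = - log 2 (card S)" using n by (simp add: log_divide)
  moreover have "prob_space.entropy M 2 (count_space (V ` space M)) V = - (real (card S) * c * log 2 c)"
    unfolding entropy_simple_sum[OF prob_space_axioms V] red by simp
  ultimately show ?thesis using n one by auto
qed

section \<open>Atoms of subvectors and the integrality of the coefficients\<close>

lemma joint_subset: "A \<subseteq> B \<Longrightarrow> joint X A = (\<lambda>v. restrict v A) \<circ> joint X B"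
  by (auto simp: joint_def fun_eq_iff restrict_def)

lemma joint_Un:
  "joint X (A \<union> B) \<omega> = joint X (A \<union> B) \<omega>' \<longleftrightarrow>
    joint X A \<omega> = joint X A \<omega>' \<and> joint X B \<omega> = joint X B \<omega>'"
  by (auto simp: joint_def fun_eq_iff restrict_def)

text \<open>Indexed by an outcome instead of a value, so that the marginal masses of one point can
  be compared for different \<open>A\<close>.\<close>

definition atom_prob :: "'w measure \<Rightarrow> (nat \<Rightarrow> 'w \<Rightarrow> 'x) \<Rightarrow> nat set \<Rightarrow> 'w \<Rightarrow> real" where
  "atom_prob M X A \<omega> = measure M (joint X A -` {joint X A \<omega>} \<inter> space M)"

lemma atom_prob_cong: "joint X A \<omega> = joint X A \<omega>' \<Longrightarrow> atom_prob M X A \<omega> = atom_prob M X A \<omega>'"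
  by (simp add: atom_prob_def)

locale random_vector = prob_space M for M :: "'w measure" +
  fixes X :: "nat \<Rightarrow> 'w \<Rightarrow> 'x"
  assumes simple: "\<forall>i\<in>N4. simple_function M (X i)"
begin

lemma simple_joint: "A \<subseteq> N4 \<Longrightarrow> simple_function M (joint X A)"
  using simple by (rule simple_function_joint[rotated])

lemma atom_prob_mono:
  assumes "A \<subseteq> B" "B \<subseteq> N4"
  shows "atom_prob M X B \<omega> \<le> atom_prob M X A \<omega>"
  unfolding atom_prob_def joint_subset[OF assms(1)]
  by (rule finite_measure_mono)
    (use simple_functionD(2)[OF simple_joint[of A]] assms joint_subset[OF assms(1), of X] in auto)

text \<open>\<open>joint X A\<close> is a function of \<open>joint X B\<close>; equal entropies say
  that it loses nothing on atoms of positive mass.\<close>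

lemma atom_prob_eq:
  assumes AB: "A \<subseteq> B" "B \<subseteq> N4"
    and H: "joint_entropy M X A = joint_entropy M X B"
    and w: "\<omega> \<in> space M" "0 < atom_prob M X B \<omega>"
  shows "atom_prob M X A \<omega> = atom_prob M X B \<omega>"
proof -
  note r = joint_subset[OF AB(1), of X]
  have "joint X B \<omega> \<in> joint X B ` space M" using w by blast
  from entropy_comp_eq_imp_prob_eq[OF simple_joint[OF AB(2)] H[unfolded joint_entropy_def r] this] w(2)
  show ?thesis by (simp add: atom_prob_def r)
qed

text \<open>The two outcomes may differ, so this also covers pairs of values not yet known to occur
  together; \<open>ex_common_atom\<close> relies on that.\<close>

lemma prob_pair_eq:
  assumes AB: "A \<subseteq> N4" "B \<subseteq> N4"
    and H: "joint_entropy M X (A \<union> B) = joint_entropy M X A + joint_entropy M X B"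
    and w: "\<omega> \<in> space M" "\<omega>' \<in> space M"
  shows "prob ((\<lambda>z. (joint X A z, joint X B z)) -` {(joint X A \<omega>, joint X B \<omega>')} \<inter> space M) =
    atom_prob M X A \<omega> * atom_prob M X B \<omega>'"
proof -
  interpret information_space M 2 by unfold_locales simp
  let ?e = "\<lambda>v. (restrict v A, restrict v B)"
  let ?W = "\<lambda>z. (joint X A z, joint X B z)"
  have W: "?W = ?e \<circ> joint X (A \<union> B)"
    by (auto simp: joint_def fun_eq_iff restrict_def)
  have s: "simple_function M (joint X (A \<union> B))" using AB by (intro simple_joint) auto
  \<comment> \<open>The pair of subvectors is an injective recoding of the subvector on the union,
    hence has the same entropy.\<close>
  have inj: "inj_on ?e (joint X (A \<union> B) ` space M)"
  proof (rule inj_onI)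
    fix x y assume "x \<in> joint X (A \<union> B) ` space M" "y \<in> joint X (A \<union> B) ` space M" and e: "?e x = ?e y"
    then obtain \<alpha> \<beta> where x: "x = joint X (A \<union> B) \<alpha>" and y: "y = joint X (A \<union> B) \<beta>" by blast
    have "?W \<alpha> = ?W \<beta>" using e fun_cong[OF W, of \<alpha>] fun_cong[OF W, of \<beta>] unfolding x y comp_def by simp
    then show "x = y" unfolding x y joint_Un by simp
  qed
  have "prob_space.entropy M 2 (count_space (?W ` space M)) ?W = joint_entropy M X (A \<union> B)"
    unfolding W joint_entropy_def by (rule entropy_of_inj[OF s inj])
  then show ?thesis
    unfolding atom_prob_def
    by (intro entropy_add_imp_prob_mult simple_joint AB) (use H w in \<open>auto simp: joint_entropy_def\<close>)
qed

lemma atom_prob_Un: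
  assumes AB: "A \<subseteq> N4" "B \<subseteq> N4"
    and H: "joint_entropy M X (A \<union> B) = joint_entropy M X A + joint_entropy M X B"
    and w: "\<omega> \<in> space M"
  shows "atom_prob M X (A \<union> B) \<omega> = atom_prob M X A \<omega> * atom_prob M X B \<omega>"
proof -
  have "joint X (A \<union> B) -` {joint X (A \<union> B) \<omega>} =
      (\<lambda>z. (joint X A z, joint X B z)) -` {(joint X A \<omega>, joint X B \<omega>)}"
    by (auto simp: joint_Un)
  then show ?thesis using prob_pair_eq[OF AB H w w] by (simp add: atom_prob_def)
qed

text \<open>By independence the two values occur together with positive probability, and that event
  contains an atom of the whole vector of positive mass.\<close>

lemma ex_common_atom:
  assumes AB: "A \<subseteq> N4" "B \<subseteq> N4"
    and H: "joint_entropy M X (A \<union> B) = joint_entropy M X A + joint_entropy M X B"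
    and w: "\<omega> \<in> space M" "\<omega>' \<in> space M" "0 < atom_prob M X A \<omega>" "0 < atom_prob M X B \<omega>'"
  obtains z where "z \<in> space M" "joint X A z = joint X A \<omega>" "joint X B z = joint X B \<omega>'"
    "0 < atom_prob M X N4 z"
proof -
  let ?W = "\<lambda>z. (joint X A z, joint X B z)"
  have W: "?W = (\<lambda>v. (restrict v A, restrict v B)) \<circ> joint X N4"
    using AB by (auto simp: joint_def fun_eq_iff restrict_def)
  have "0 < prob (?W -` {(joint X A \<omega>, joint X B \<omega>')} \<inter> space M)"
    unfolding prob_pair_eq[OF AB H w(1,2)] using w by simp
  from ex_pos_atom[OF simple_joint this W] show ?thesis
    using that unfolding atom_prob_def by blast
qed

lemma joint_entropy_equal_atoms:
  assumes A: "A \<subseteq> N4"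
    and c: "\<And>\<omega>. \<omega> \<in> space M \<Longrightarrow> 0 < atom_prob M X A \<omega> \<Longrightarrow> atom_prob M X A \<omega> = c"
  shows "\<exists>n::nat. 0 < n \<and> joint_entropy M X A = log 2 n"
  unfolding joint_entropy_def
  by (rule entropy_equal_atoms[OF simple_joint[OF A]]) (use c in \<open>auto simp: atom_prob_def\<close>)

text \<open>The hypotheses are rank identities that hold on the face, where the values at
  \<open>{3}\<close> and \<open>{4}\<close> are the two coefficients.\<close>

lemma joint_entropy_log_nat:
  assumes H12: "joint_entropy M X {1, 2} = joint_entropy M X N4"
    and H134: "joint_entropy M X {1, 3, 4} = joint_entropy M X N4"
    and H234: "joint_entropy M X {2, 3, 4} = joint_entropy M X N4"
    and I12: "joint_entropy M X {1, 2} = joint_entropy M X {1} + joint_entropy M X {2}"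
    and I34: "joint_entropy M X {3, 4} = joint_entropy M X {3} + joint_entropy M X {4}"
    and I134: "joint_entropy M X {1, 3, 4} = joint_entropy M X {1} + joint_entropy M X {3, 4}"
    and I234: "joint_entropy M X {2, 3, 4} = joint_entropy M X {2} + joint_entropy M X {3, 4}"
  shows "\<exists>(m::nat) (n::nat). 0 < m \<and> 0 < n \<and> joint_entropy M X {3} = log 2 m \<and> joint_entropy M X {4} = log 2 n"
proof -
  let ?q = "atom_prob M X"
  \<comment> \<open>The mass of the full atom is written as q1 q2, as q1 q3 q4 and as q2 q3 q4;
    cancelling q1 or q2, both positive, leaves the claim.\<close>
  have split: "?q {1} z = ?q {3} z * ?q {4} z \<and> ?q {2} z = ?q {3} z * ?q {4} z"
    if z: "z \<in> space M" "0 < ?q N4 z" for z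
  proof -
    have pos: "0 < ?q {1} z" "0 < ?q {2} z"
      using z atom_prob_mono[of "{1}" N4 z] atom_prob_mono[of "{2}" N4 z] by simp_all
    have un: "{1} \<union> {2} = {1, 2::nat}" "{3} \<union> {4} = {3, 4::nat}"
      "{1} \<union> {3, 4} = {1, 3, 4::nat}" "{2} \<union> {3, 4} = {2, 3, 4::nat}" by auto
    have "?q {1, 2} z = ?q N4 z" by (rule atom_prob_eq[OF _ _ H12 z]) auto
    moreover have "?q {1, 3, 4} z = ?q N4 z" by (rule atom_prob_eq[OF _ _ H134 z]) auto
    moreover have "?q {2, 3, 4} z = ?q N4 z" by (rule atom_prob_eq[OF _ _ H234 z]) auto
    moreover have "?q {1, 2} z = ?q {1} z * ?q {2} z"
      using atom_prob_Un[of "{1}" "{2}" z] I12 z unfolding un by simp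
    moreover have "?q {3, 4} z = ?q {3} z * ?q {4} z"
      using atom_prob_Un[of "{3}" "{4}" z] I34 z unfolding un by simp
    moreover have "?q {1, 3, 4} z = ?q {1} z * ?q {3, 4} z"
      using atom_prob_Un[of "{1}" "{3, 4}" z] I134 z unfolding un by simp
    moreover have "?q {2, 3, 4} z = ?q {2} z * ?q {3, 4} z"
      using atom_prob_Un[of "{2}" "{3, 4}" z] I234 z unfolding un by simp
    ultimately have "?q {1} z * ?q {2} z = ?q {1} z * (?q {3} z * ?q {4} z)"
      "?q {2} z * ?q {1} z = ?q {2} z * (?q {3} z * ?q {4} z)"
      by (simp_all only: mult.commute[of "?q {2} z" "?q {1} z"])
    then show ?thesis using pos by (metis less_irrefl mult_left_cancel)
  qed
  have nn: "0 \<le> ?q A \<omega>" for A \<omega> by (simp add: atom_prob_def)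
  \<comment> \<open>A reference outcome: the whole space, as the event of a constant map, has
    probability 1 and so contains a positive atom.\<close>
  obtain z0 where z0: "z0 \<in> space M" "0 < ?q N4 z0"
  proof -
    have "0 < prob ((\<lambda>_. ()) -` {()} \<inter> space M)" by (simp add: prob_space)
    from ex_pos_atom[OF simple_joint this, of N4 "\<lambda>_. ()"] show ?thesis
      using that by (auto simp: atom_prob_def comp_def)
  qed
  have c: "?q {3} z * ?q {4} z = ?q {3} z0 * ?q {4} z0" if z: "z \<in> space M" "0 < ?q N4 z" for z
  proof -
    have "0 < ?q {1} z" "0 < ?q {2} z0"
      using z z0 atom_prob_mono[of "{1}" N4 z] atom_prob_mono[of "{2}" N4 z0] by simp_all
    \<comment> \<open>\<open>y\<close> links \<open>z\<close> to \<open>z0\<close> through q1(z) =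
      q1(y) = q2(y) = q2(z0), the middle equality being \<open>split\<close> at
      \<open>y\<close>.\<close>
    then obtain y where y: "y \<in> space M" "joint X {1} y = joint X {1} z"
      "joint X {2} y = joint X {2} z0" "0 < ?q N4 y"
      using ex_common_atom[of "{1}" "{2}" z z0] I12 z z0 by (auto simp: insert_commute)
    show ?thesis
      using split[OF z] split[OF z0] split[OF y(1,4)] atom_prob_cong[OF y(2), of M] atom_prob_cong[OF y(3), of M]
      by simp
  qed
  \<comment> \<open>Only the separate atoms of X3 at \<open>z\<close> and X4 at \<open>z'\<close>
    need be positive, so one factor can be varied while the other stays at
    \<open>z0\<close>.\<close>
  have c': "?q {3} z * ?q {4} z' = ?q {3} z0 * ?q {4} z0"
    if z: "z \<in> space M" "0 < ?q {3} z" "z' \<in> space M" "0 < ?q {4} z'" for z z'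
  proof -
    obtain y where y: "y \<in> space M" "joint X {3} y = joint X {3} z"
      "joint X {4} y = joint X {4} z'" "0 < ?q N4 y"
      using ex_common_atom[of "{3}" "{4}" z z'] I34 z by (auto simp: insert_commute)
    show ?thesis
      using c[OF y(1,4)] atom_prob_cong[OF y(2), of M] atom_prob_cong[OF y(3), of M] by simp
  qed
  have pos: "0 < ?q {3} z0" "0 < ?q {4} z0"
    using z0 atom_prob_mono[of "{3}" N4 z0] atom_prob_mono[of "{4}" N4 z0] by simp_all
  \<comment> \<open>With \<open>z'\<close> = \<open>z0\<close> the positive factor q4(z0) cancels,
    so q3 is constant on its positive atoms; the same works for q4.\<close>
  have "\<exists>m::nat. 0 < m \<and> joint_entropy M X {3} = log 2 m"
    by (rule joint_entropy_equal_atoms[where c = "?q {3} z0"])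
      (use c'[OF _ _ z0(1) pos(2)] pos in auto)
  moreover have "\<exists>n::nat. 0 < n \<and> joint_entropy M X {4} = log 2 n"
    by (rule joint_entropy_equal_atoms[where c = "?q {4} z0"])
      (use c'[OF z0(1) pos(1)] pos in auto)
  ultimately show ?thesis by blast
qed

end

section \<open>Construction of random vectors from modular sums\<close>

text \<open>Every value has probability k / |S|, so the logarithm is a constant factor and the
  remaining sum is 1. Thus entropies reduce to counting fibres.\<close>

lemma entropy_uniform_equal_fibres:
  assumes fin: "finite S" "S \<noteq> {}"
    and k: "\<And>\<omega>. \<omega> \<in> S \<Longrightarrow> card {z\<in>S. f z = f \<omega>} = k"
  shows "prob_space.entropy (uniform_count_measure S) 2
      (count_space (f ` space (uniform_count_measure S))) f = log 2 (real (card S) / real k)"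
proof -
  let ?M = "uniform_count_measure S"
  interpret prob_space ?M using fin by (rule prob_space_uniform_count_measure)
  have f: "simple_function ?M f"
    using fin by (auto simp: simple_function_def space_uniform_count_measure sets_uniform_count_measure)
  have p: "prob (f -` {x} \<inter> S) = real k / real (card S)" if x: "x \<in> f ` S" for x
  proof -
    obtain \<omega> where \<omega>: "\<omega> \<in> S" "x = f \<omega>" using x by blast
    have "f -` {x} \<inter> S = {z\<in>S. f z = f \<omega>}" using \<omega> by auto
    then show ?thesis using k[OF \<omega>(1)] fin by (simp add: measure_uniform_count_measure)
  qed
  have sp: "(\<Sum>x\<in>f ` S. prob (f -` {x} \<inter> S)) = 1"
    using sum_prob_range[OF f] by (simp add: space_uniform_count_measure)
  have "(\<Sum>x\<in>f ` S. prob (f -` {x} \<inter> S) * log 2 (prob (f -` {x} \<inter> S))) =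
      (\<Sum>x\<in>f ` S. prob (f -` {x} \<inter> S) * log 2 (real k / real (card S)))"
    by (rule sum.cong) (simp_all add: p)
  also have "\<dots> = log 2 (real k / real (card S))"
    unfolding sum_distrib_right[symmetric] sp by simp
  finally have 1: "prob_space.entropy ?M 2 (count_space (f ` space ?M)) f = - log 2 (real k / real (card S))"
    unfolding entropy_simple_sum[OF prob_space_axioms f] by (simp add: space_uniform_count_measure)
  obtain \<omega> where "\<omega> \<in> S" using fin by blast
  then have "0 < k" using k[of \<omega>] fin by (auto simp: card_gt_0_iff)
  moreover have "0 < card S" using fin by (simp add: card_gt_0_iff)
  ultimately show ?thesis unfolding 1 by (simp add: log_divide)
qed

text \<open>The code (x, y, x + y) over Z/v, which represents U_{2,3}. Every index other than 1 and
  2 carries the sum, so the same code serves for index 3 and for index 4.\<close>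

definition sum_code :: "nat \<Rightarrow> nat \<Rightarrow> nat \<times> nat \<Rightarrow> nat" where
  "sum_code v i p = (if i = 1 then fst p else if i = 2 then snd p else (fst p + snd p) mod v)"

lemma add_mod_cancel:
  fixes v :: nat
  assumes "(a + x) mod v = (a + y) mod v" "x < v" "y < v"
  shows "x = y"
proof (rule linorder_cases[of x y])
  assume "x < y"
  then have "v dvd y - x" using assms(1) mod_eq_dvd_iff_nat[of "a + x" "a + y" v] by simp
  then show ?thesis using \<open>x < y\<close> assms(3) by (auto dest: dvd_imp_le)
next
  assume "y < x"
  then have "v dvd x - y" using assms(1) mod_eq_dvd_iff_nat[of "a + y" "a + x" v] by simp
  then show ?thesis using \<open>y < x\<close> assms(2) by (auto dest: dvd_imp_le)
qed

text \<open>The first summand is arbitrary and determines the second, so projecting to it is a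
  bijection onto the residues.\<close>

lemma card_add_mod_fibre:
  fixes v :: nat
  assumes "k < v"
  shows "card {p \<in> {..<v} \<times> {..<v}. (fst p + snd p) mod v = k} = v"
proof -
  have "bij_betw fst {p \<in> {..<v} \<times> {..<v}. (fst p + snd p) mod v = k} {..<v}"
    unfolding bij_betw_def
  proof (intro conjI inj_onI subset_antisym subsetI)
    fix p q assume p: "p \<in> {p \<in> {..<v} \<times> {..<v}. (fst p + snd p) mod v = k}"
      and q: "q \<in> {p \<in> {..<v} \<times> {..<v}. (fst p + snd p) mod v = k}" and "fst p = fst q"
    then show "p = q" using add_mod_cancel[of "fst p" "snd p" v "snd q"] by (auto simp: prod_eq_iff)
  next
    fix a assume a: "a \<in> {..<v}"
    \<comment> \<open>The second summand is k - a modulo v; writing v - a avoids truncated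
      subtraction because a < v.\<close>
    have "(a + (k + (v - a)) mod v) mod v = (a + (k + (v - a))) mod v" by (rule mod_add_right_eq)
    also have "\<dots> = k" using a assms by simp
    finally have "(a, (k + (v - a)) mod v) \<in> {p \<in> {..<v} \<times> {..<v}. (fst p + snd p) mod v = k}"
      using a assms by simp
    then show "a \<in> fst ` {p \<in> {..<v} \<times> {..<v}. (fst p + snd p) mod v = k}"
      by (rule rev_image_eqI) simp
  qed auto
  then show ?thesis by (simp add: bij_betw_same_card)
qed

text \<open>Each prescribed coordinate removes one factor \<open>v\<close> until two are fixed; any
  two determine the pair. The exponent is therefore 2 minus the rank.\<close>

lemma card_sum_code_fibre:
  fixes v c :: nat
  assumes c: "c \<noteq> 1" "c \<noteq> 2" and p: "p \<in> {..<v} \<times> {..<v}"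
  shows "card {q \<in> {..<v} \<times> {..<v}. \<forall>i\<in>A \<inter> {1, 2, c}. sum_code v i q = sum_code v i p} =
    v ^ (2 - min 2 (card (A \<inter> {1, 2, c})))"
proof -
  obtain a b where ab: "p = (a, b)" "a < v" "b < v" using p by auto
  let ?F = "{q \<in> {..<v} \<times> {..<v}. \<forall>i\<in>A \<inter> {1, 2, c}. sum_code v i q = sum_code v i p}"
  \<comment> \<open>Cancellation recovers the missing summand when the sum and the other summand are
    given.\<close>
  have a': "x = a" if "(x + b) mod v = (a + b) mod v" "x < v" for x
    using add_mod_cancel[of b x v a] that ab by (simp add: add.commute)
  have b': "x = b" if "(a + x) mod v = (a + b) mod v" "x < v" for x
    using add_mod_cancel[of a x v b] that ab by simp
  have single: "card ?F = 1" if "?F = {p}" using that by simp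
  consider "A \<inter> {1, 2, c} = {}" | "A \<inter> {1, 2, c} = {1}" | "A \<inter> {1, 2, c} = {2}"
    | "A \<inter> {1, 2, c} = {c}" | "A \<inter> {1, 2, c} = {1, 2}" | "A \<inter> {1, 2, c} = {1, c}"
    | "A \<inter> {1, 2, c} = {2, c}" | "A \<inter> {1, 2, c} = {1, 2, c}"
    by blast
  then show ?thesis
  proof cases
    case 1
    then show ?thesis unfolding 1 by (simp add: card_cartesian_product power2_eq_square)
  next
    case 2
    have "?F = {a} \<times> {..<v}" unfolding 2 using ab by (auto simp: sum_code_def)
    then show ?thesis unfolding 2 by (simp add: card_cartesian_product)
  next
    case 3
    have "?F = {..<v} \<times> {b}" unfolding 3 using ab by (auto simp: sum_code_def)
    then show ?thesis unfolding 3 by (simp add: card_cartesian_product)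
  next
    case 4
    have "?F = {q \<in> {..<v} \<times> {..<v}. (fst q + snd q) mod v = (a + b) mod v}"
      unfolding 4 using ab c by (auto simp: sum_code_def)
    then show ?thesis unfolding 4 using ab card_add_mod_fibre[of "(a + b) mod v" v] by simp
  next
    case 5
    have "?F = {p}" unfolding 5 using ab by (auto simp: sum_code_def)
    from single[OF this] show ?thesis unfolding 5 by simp
  next
    case 6
    have "?F = {p}" unfolding 6 using ab c b' by (auto simp: sum_code_def)
    from single[OF this] show ?thesis unfolding 6 using c by simp
  next
    case 7
    have "?F = {p}" unfolding 7 using ab c a' by (auto simp: sum_code_def)
    from single[OF this] show ?thesis unfolding 7 using c by simp
  next
    case 8
    have "?F = {p}" unfolding 8 using ab c by (auto simp: sum_code_def)
    from single[OF this] show ?thesis unfolding 8 using c by simp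
  qed
qed

lemma log_power_ratio:
  assumes "0 < v" "r \<le> 2"
  shows "log 2 (real (v ^ 2) / real (v ^ (2 - r))) = real r * log 2 (real v)"
proof -
  have "log 2 (real (v ^ 2) / real (v ^ (2 - r))) = 2 * log 2 v - real (2 - r) * log 2 v"
    using assms by (simp add: log_divide log_nat_power)
  then show ?thesis using assms by (simp add: of_nat_diff algebra_simps)
qed

lemma entropic_point_log:
  fixes v w :: nat
  assumes v: "0 < v" and w: "0 < w"
  shows "entropic (point (U23 {1, 2, 3}) (U23 {1, 2, 4}) (log 2 v) (log 2 w))"
proof -
  define S where "S = ({..<v} \<times> {..<v}) \<times> ({..<w} \<times> {..<w})"
  \<comment> \<open>Two independent copies of the code, one per matroid. The constant 0 stands at
    the loop of each matroid: index 4 in the first, index 3 in the second.\<close>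
  define X where "X i z = (if i \<in> {1, 2, 3} then sum_code v i (fst z) else 0,
      if i \<in> {1, 2, 4} then sum_code w i (snd z) else 0)" for i and z :: "(nat \<times> nat) \<times> (nat \<times> nat)"
  let ?M = "uniform_count_measure S"
  have S: "finite S" "S \<noteq> {}" using v w by (auto simp: S_def)
  have cS: "card S = v ^ 2 * w ^ 2" by (simp add: S_def card_cartesian_product power2_eq_square)
  have simp: "\<forall>i\<in>N4. simple_function ?M (X i)"
    using S by (auto simp: simple_function_def space_uniform_count_measure sets_uniform_count_measure)
  have H: "joint_entropy ?M X A = point (U23 {1, 2, 3}) (U23 {1, 2, 4}) (log 2 v) (log 2 w) A" for A
  proof -
    let ?r = "min 2 (card (A \<inter> {1, 2, 3}))" and ?s = "min 2 (card (A \<inter> {1, 2, 4}))"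
    have fib: "card {z\<in>S. joint X A z = joint X A \<omega>} = v ^ (2 - ?r) * w ^ (2 - ?s)" if \<omega>: "\<omega> \<in> S" for \<omega>
    proof -
      \<comment> \<open>The constraints on the two copies are separate, so fibres are products and
        the two ranks add in the exponents.\<close>
      have "{z\<in>S. joint X A z = joint X A \<omega>} =
        {q \<in> {..<v} \<times> {..<v}. \<forall>i\<in>A \<inter> {1, 2, 3}. sum_code v i q = sum_code v i (fst \<omega>)} \<times>
        {q \<in> {..<w} \<times> {..<w}. \<forall>i\<in>A \<inter> {1, 2, 4}. sum_code w i q = sum_code w i (snd \<omega>)}"
      proof -
        have "joint X A z = joint X A \<omega> \<longleftrightarrow>
          (\<forall>i\<in>A \<inter> {1, 2, 3}. sum_code v i (fst z) = sum_code v i (fst \<omega>)) \<and>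
          (\<forall>i\<in>A \<inter> {1, 2, 4}. sum_code w i (snd z) = sum_code w i (snd \<omega>))" for z
        proof -
          have "joint X A z = joint X A \<omega> \<longleftrightarrow> (\<forall>i\<in>A. X i z = X i \<omega>)"
            by (auto simp: joint_def fun_eq_iff restrict_def)
          also have "\<dots> \<longleftrightarrow> (\<forall>i\<in>A. (i \<in> {1, 2, 3} \<longrightarrow> sum_code v i (fst z) = sum_code v i (fst \<omega>)) \<and>
              (i \<in> {1, 2, 4} \<longrightarrow> sum_code w i (snd z) = sum_code w i (snd \<omega>)))"
            by (rule ball_cong[OF refl]) (simp add: X_def)
          finally show ?thesis by blast
        qed
        then show ?thesis by (auto simp: S_def)
      qed
      moreover have "fst \<omega> \<in> {..<v} \<times> {..<v}" "snd \<omega> \<in> {..<w} \<times> {..<w}"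
        using \<omega> by (auto simp: S_def)
      ultimately show ?thesis
        using card_sum_code_fibre[of 3 "fst \<omega>" v A] card_sum_code_fibre[of 4 "snd \<omega>" w A]
        by (simp add: card_cartesian_product)
    qed
    have "joint_entropy ?M X A = log 2 (real (card S) / real (v ^ (2 - ?r) * w ^ (2 - ?s)))"
      unfolding joint_entropy_def by (rule entropy_uniform_equal_fibres[OF S fib])
    also have "\<dots> = log 2 ((real (v ^ 2) / real (v ^ (2 - ?r))) * (real (w ^ 2) / real (w ^ (2 - ?s))))"
      by (simp add: cS)
    also have "\<dots> = log 2 (real (v ^ 2) / real (v ^ (2 - ?r))) + log 2 (real (w ^ 2) / real (w ^ (2 - ?s)))"
      using v w by (intro log_mult_pos) auto
    also have "\<dots> = real ?r * log 2 v + real ?s * log 2 w"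
      using v w by (simp only: log_power_ratio min.cobounded1)
    finally show ?thesis by (simp add: point_def U23_def)
  qed
  \<comment> \<open>\<open>entropic_joint_entropy\<close> transfers the vector to the sample space
    and alphabets fixed in \<open>entropic\<close>.\<close>
  show ?thesis
    by (rule entropic_joint_entropy[OF prob_space_uniform_count_measure[OF S] simp]) (simp add: H)
qed

theorem mainTheorem10:
  fixes F :: "set_function set" and h :: set_function and a b :: real
  assumes "F = face (U23 {1, 2, 3}) (U23 {1, 2, 4})"
    and "a \<ge> 0" and "b \<ge> 0"
    and "h = point (U23 {1, 2, 3}) (U23 {1, 2, 4}) a b" and "h \<in> F"
  shows "entropic h \<longleftrightarrow>
    (\<exists>v1 v2 :: nat. v1 > 0 \<and> v2 > 0 \<and> a = log 2 (real v1) \<and> b = log 2 (real v2))"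
proof
  assume "entropic h"
  then obtain M :: "(nat \<Rightarrow> nat) measure" and X :: "nat \<Rightarrow> (nat \<Rightarrow> nat) \<Rightarrow> nat"
    where M: "prob_space M" and X: "\<forall>i\<in>N4. simple_function M (X i)"
      and h: "\<And>A. A \<subseteq> N4 \<Longrightarrow> joint_entropy M X A = h A"
    unfolding entropic_def by force
  interpret random_vector M X
    using M X by (intro random_vector.intro random_vector_axioms.intro)
  show "\<exists>v1 v2 :: nat. v1 > 0 \<and> v2 > 0 \<and> a = log 2 (real v1) \<and> b = log 2 (real v2)"
    \<comment> \<open>Evaluating the ranks turns the seven hypotheses into identities in a and b,
      and the entropies at \<open>{3}\<close> and \<open>{4}\<close> into a and b.\<close>
    using joint_entropy_log_nat by (simp add: h assms(4) point_def U23_def)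
next
  assume "\<exists>v1 v2 :: nat. v1 > 0 \<and> v2 > 0 \<and> a = log 2 (real v1) \<and> b = log 2 (real v2)"
  then show "entropic h" using entropic_point_log assms(4) by blast
qed

end
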